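(* Let $G$ be a finite simple undirected graph with $\chi(G) \leq 6$ that admits exactly one coloring of size $\chi(G)$. Then $h(G) \geq \chi(G)$.
   Context: An anticlique of $G$ is a set of pairwise nonadjacent vertices. A coloring of $G$ is a partition of $V(G)$ into (nonempty) anticliques; its size is the number of classes; $\chi(G)$ is the smallest size of a coloring of $G$. A subset of $V(G)$ is connected if it induces a connected subgraph; two subsets of $V(G)$ are adjacent if some edge of $G$ has one end in each. A clique minor of $G$ is a set of pairwise disjoint, pairwise adjacent, connected, nonempty subsets of $V(G)$. $h(G)$ denotes the largest $k$ such that $G$ has a clique minor of size $k$. *)

theory Defs
  imports Main "HOL-Library.Disjoint_Sets"
begin

text \<open>
  A graph is given by its vertex set \<open>V\<close> and its adjacency relation \<open>E\<close>, so an undirected edge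
  appears as the two pairs \<open>(u, v)\<close> and \<open>(v, u)\<close>. The graph without vertices is allowed.
\<close>

definition finite_simple_graph :: "'a set \<Rightarrow> 'a rel \<Rightarrow> bool" where
  "finite_simple_graph V E \<longleftrightarrow> finite V \<and> E \<subseteq> V \<times> V \<and> sym E \<and> irrefl E"

definition anticlique :: "'a rel \<Rightarrow> 'a set \<Rightarrow> bool" where
  "anticlique E A \<longleftrightarrow> (\<forall>u\<in>A. \<forall>v\<in>A. (u, v) \<notin> E)"

text \<open>The library's \<open>partition_on\<close> requires the classes to be nonempty.\<close>

definition coloring :: "'a set \<Rightarrow> 'a rel \<Rightarrow> 'a set set \<Rightarrow> bool" where
  "coloring V E C \<longleftrightarrow> partition_on V C \<and> (\<forall>A\<in>C. anticlique E A)"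

definition chromatic_number :: "'a set \<Rightarrow> 'a rel \<Rightarrow> nat" where
  "chromatic_number V E = (LEAST k. \<exists>C. coloring V E C \<and> card C = k)"

text \<open>The relation \<open>E \<inter> S \<times> S\<close> is the adjacency relation of the subgraph induced by \<open>S\<close>.\<close>

definition connected_set :: "'a rel \<Rightarrow> 'a set \<Rightarrow> bool" where
  "connected_set E S \<longleftrightarrow> (\<forall>u\<in>S. \<forall>v\<in>S. (u, v) \<in> (E \<inter> S \<times> S)\<^sup>*)"

definition adjacent_sets :: "'a rel \<Rightarrow> 'a set \<Rightarrow> 'a set \<Rightarrow> bool" where
  "adjacent_sets E A B \<longleftrightarrow> (\<exists>a\<in>A. \<exists>b\<in>B. (a, b) \<in> E)"

definition clique_minor :: "'a set \<Rightarrow> 'a rel \<Rightarrow> 'a set set \<Rightarrow> bool" where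
  "clique_minor V E M \<longleftrightarrow>
     (\<forall>A\<in>M. A \<subseteq> V \<and> A \<noteq> {} \<and> connected_set E A) \<and>
     pairwise disjnt M \<and> pairwise (adjacent_sets E) M"

text \<open>
  For finite \<open>V\<close> the set below is finite, since clique minors are subsets of \<open>Pow V\<close>, and it
  contains \<open>0\<close>, the size of the empty clique minor.
\<close>

definition hadwiger_number :: "'a set \<Rightarrow> 'a rel \<Rightarrow> nat" where
  "hadwiger_number V E = Max {k. \<exists>M. clique_minor V E M \<and> card M = k}"

end

theory Submission
  imports Defs
begin

text \<open>
  In a graph with a unique coloring of minimum size \<open>k\<close>, any two color classes induce a connected
  subgraph, since otherwise exchanging the two colors on a component gives another coloring.
  Counting edges between classes yields at least \<open>(k - 1) n - k (k - 1) / 2\<close> edges.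

  For \<open>k \<le> 6\<close> this density forces a clique minor of size \<open>k\<close>. An edge-minimal and vertex-minimal
  counterexample to a bound \<open>a n - b\<close> has all edges in at least \<open>a\<close> triangles, as contracting
  an edge loses one more edge than the triangles through it. If \<open>b > 0\<close>, some vertex has degree
  below \<open>2 a\<close>, and its neighbourhood induces a small graph of minimum degree at least \<open>a\<close>, dense
  enough for a clique minor of size \<open>k - 1\<close>. The bounds for \<open>k = 2, \<dots>, 6\<close> are \<open>1\<close>, \<open>n\<close>,
  \<open>2 n - 2\<close>, \<open>3 n - 5\<close> and \<open>5 n - 15\<close>. Below, \<open>card E\<close> is twice the number of edges.
\<close>

subsection \<open>Clique minors\<close>

text \<open>Finiteness of \<open>M\<close> rules out the default value 0 of \<open>card\<close> on
  infinite sets, as \<open>V\<close> may be infinite here.\<close>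

definition has_clique_minor :: "'a set \<Rightarrow> 'a rel \<Rightarrow> nat \<Rightarrow> bool" where
  "has_clique_minor V E k \<longleftrightarrow> (\<exists>M. clique_minor V E M \<and> finite M \<and> card M = k)"

lemma connected_set_mono: "connected_set E S \<Longrightarrow> E \<subseteq> E' \<Longrightarrow> connected_set E' S"
  unfolding connected_set_def
  by (meson Int_mono rtrancl_mono subset_iff subset_refl)

lemma adjacent_sets_mono: "adjacent_sets E A B \<Longrightarrow> E \<subseteq> E' \<Longrightarrow> adjacent_sets E' A B"
  unfolding adjacent_sets_def by blast

lemma connected_set_singleton: "connected_set E {v}"
  by (simp add: connected_set_def)

lemma has_clique_minor_mono:
  assumes "has_clique_minor V E k" "V \<subseteq> V'" "E \<subseteq> E'"
  shows "has_clique_minor V' E' k"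
proof -
  have "clique_minor V' E' M" if "clique_minor V E M" for M
    unfolding clique_minor_def
  proof (intro conjI ballI)
    show "pairwise (adjacent_sets E') M"
      using that adjacent_sets_mono[OF _ assms(3)] unfolding clique_minor_def
      by (auto intro: pairwise_mono)
  qed (use that assms(2) connected_set_mono[OF _ assms(3)] in \<open>auto simp: clique_minor_def\<close>)
  then show ?thesis
    using assms(1) by (auto simp: has_clique_minor_def)
qed

lemma hadwiger_number_ge:
  assumes "finite V" "has_clique_minor V E k"
  shows "k \<le> hadwiger_number V E"
proof -
  have "{k. \<exists>M. clique_minor V E M \<and> card M = k} \<subseteq> card ` Pow (Pow V)"
    by (auto simp: clique_minor_def)
  then have "finite {k. \<exists>M. clique_minor V E M \<and> card M = k}"
    using assms(1) by (meson finite_Pow_iff finite_imageI finite_subset)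
  then show ?thesis
    unfolding hadwiger_number_def using assms(2)
    by (intro Max_ge) (auto simp: has_clique_minor_def)
qed

text \<open>All branch sets are nonempty sets of neighbours of \<open>v\<close>, so
  \<open>{v}\<close> is disjoint from and adjacent to each of them and can join the minor.\<close>

lemma has_clique_minor_cone:
  assumes G: "finite_simple_graph V E" and v: "v \<in> V"
    and N: "has_clique_minor (E `` {v}) (E \<inter> (E `` {v}) \<times> (E `` {v})) k"
  shows "has_clique_minor V E (Suc k)"
proof -
  let ?W = "E `` {v}"
  obtain M where M: "clique_minor ?W (E \<inter> ?W \<times> ?W) M" "finite M" "card M = k"
    using N by (auto simp: has_clique_minor_def)
  have E: "E \<subseteq> V \<times> V" "sym E" "irrefl E"
    using G by (auto simp: finite_simple_graph_def)
  have sub: "A \<subseteq> ?W" "A \<noteq> {}" "connected_set E A" if "A \<in> M" for A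
    using M(1) that connected_set_mono[of "E \<inter> ?W \<times> ?W" A E] by (auto simp: clique_minor_def)
  have vW: "v \<notin> ?W"
    using E by (auto simp: irrefl_def)
  have "{v} \<notin> M"
    using sub(1) vW by blast
  moreover have "clique_minor V E (insert {v} M)"
    unfolding clique_minor_def
  proof (intro conjI ballI)
    fix A assume "A \<in> insert {v} M"
    then show "A \<subseteq> V" "A \<noteq> {}" "connected_set E A"
      using sub[of A] E(1) v connected_set_singleton[of E v] by auto
  next
    show "pairwise disjnt (insert {v} M)"
      using M(1) sub(1) vW unfolding clique_minor_def pairwise_insert disjnt_def by blast
  next
    have "adjacent_sets E {v} A" "adjacent_sets E A {v}" if "A \<in> M" for A
      using sub[OF that] E(2) unfolding adjacent_sets_def sym_def by blast+
    moreover have "pairwise (adjacent_sets E) M"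
      using M(1) adjacent_sets_mono[of "E \<inter> ?W \<times> ?W" _ _ E] unfolding clique_minor_def
      by (auto intro: pairwise_mono)
    ultimately show "pairwise (adjacent_sets E) (insert {v} M)"
      by (auto simp: pairwise_insert)
  qed
  ultimately show ?thesis
    using M unfolding has_clique_minor_def by (intro exI[of _ "insert {v} M"]) auto
qed

text \<open>Branch sets of the quotient by \<open>f\<close> are pulled back to their preimages. A
  preimage stays connected because each quotient edge lifts to an edge and each fibre links the ends
  of consecutive lifts. Subtracting \<open>Id\<close> discards the loops that arise inside
  fibres.\<close>

lemma has_clique_minor_contract_fibres:
  assumes fV: "f ` V = V'" and E: "E \<subseteq> V \<times> V"
    and fibre: "\<And>a. a \<in> V' \<Longrightarrow> connected_set E {v \<in> V. f v = a}"
    and minor: "has_clique_minor V' (map_prod f f ` E - Id) k"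
  shows "has_clique_minor V E k"
proof -
  let ?E = "map_prod f f ` E - Id"
  define P where "P B = {v \<in> V. f v \<in> B}" for B
  obtain M where M: "clique_minor V' ?E M" "finite M" "card M = k"
    using minor by (auto simp: has_clique_minor_def)
  have sub: "B \<subseteq> V'" "B \<noteq> {}" "connected_set ?E B" if "B \<in> M" for B
    using M(1) that by (auto simp: clique_minor_def)
  have img: "f ` P B = B" if "B \<in> M" for B
    using sub(1)[OF that] fV by (auto simp: P_def)
  have inj: "inj_on P M"
    using img by (metis inj_onI)
  have conn: "connected_set E (P B)" if B: "B \<in> M" for B
    unfolding connected_set_def
  proof (intro ballI)
    fix u w assume u: "u \<in> P B" and w: "w \<in> P B"
    have inner: "(s, t) \<in> (E \<inter> P B \<times> P B)\<^sup>*" if "s \<in> P B" "t \<in> P B" "f s = f t" for s t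
    proof -
      let ?F = "{v \<in> V. f v = f t}"
      have "f t \<in> V'"
        using that(2) fV by (auto simp: P_def)
      then have "connected_set E ?F"
        by (rule fibre)
      then have "(s, t) \<in> (E \<inter> ?F \<times> ?F)\<^sup>*"
        using that unfolding connected_set_def by (auto simp: P_def)
      moreover have "E \<inter> ?F \<times> ?F \<subseteq> E \<inter> P B \<times> P B"
        using that by (auto simp: P_def)
      ultimately show ?thesis
        using rtrancl_mono by blast
    qed
    have "(f u, f w) \<in> (?E \<inter> B \<times> B)\<^sup>*"
      using sub(3)[OF B] u w unfolding connected_set_def by (auto simp: P_def)
    \<comment> \<open>Induction along a path of the quotient needs every vertex above its current
      end, since the next edge may lift at any of them.\<close>
    then have "\<forall>t\<in>P B. f t = f w \<longrightarrow> (u, t) \<in> (E \<inter> P B \<times> P B)\<^sup>*"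
    proof (induction rule: rtrancl_induct)
      case base
      then show ?case using inner u by auto
    next
      case (step a b)
      then obtain s t where st: "(s, t) \<in> E" "f s = a" "f t = b" "a \<in> B" "b \<in> B"
        by auto
      then have P: "s \<in> P B" "t \<in> P B"
        using E by (auto simp: P_def)
      with step.IH st have "(u, t) \<in> (E \<inter> P B \<times> P B)\<^sup>*"
        by (auto intro: rtrancl_into_rtrancl)
      then show ?case
        using inner P st(3) by (metis rtrancl_trans)
    qed
    then show "(u, w) \<in> (E \<inter> P B \<times> P B)\<^sup>*"
      using w by blast
  qed
  have "clique_minor V E (P ` M)"
    unfolding clique_minor_def
  proof (intro conjI ballI)
    fix A assume "A \<in> P ` M"
    then obtain B where B: "B \<in> M" "A = P B" by blast
    then show "A \<subseteq> V" "connected_set E A"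
      using conn by (auto simp: P_def)
    show "A \<noteq> {}"
      using img[OF B(1)] sub(2)[OF B(1)] B(2) by auto
  next
    show "pairwise disjnt (P ` M)"
      using M(1) unfolding clique_minor_def pairwise_def disjnt_def P_def by blast
  next
    have "adjacent_sets E (P A) (P B)" if adj: "adjacent_sets ?E A B" for A B
    proof -
      obtain a b where "a \<in> A" "b \<in> B" "(a, b) \<in> ?E"
        using adj unfolding adjacent_sets_def by blast
      then obtain u w where "(u, w) \<in> E" "f u \<in> A" "f w \<in> B"
        by auto
      then have "u \<in> P A" "w \<in> P B" "(u, w) \<in> E"
        using E by (auto simp: P_def)
      then show ?thesis
        unfolding adjacent_sets_def by blast
    qed
    then show "pairwise (adjacent_sets E) (P ` M)"
      using M(1) unfolding clique_minor_def by (metis (no_types, lifting) pairwiseD pairwise_imageI)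
  qed
  then show ?thesis
    using M inj unfolding has_clique_minor_def
    by (intro exI[of _ "P ` M"]) (auto simp: card_image)
qed

text \<open>Merging \<open>y\<close> into \<open>x\<close> loses the edge \<open>xy\<close> and
  merges the two edges from each common neighbour into one. Hence the loss is at most one edge plus
  one per triangle, counted twice in arcs.\<close>

lemma contract_edge:
  fixes V :: "'a set"
  assumes G: "finite_simple_graph V E" and xy: "(x, y) \<in> E"
  obtains E' where "finite_simple_graph (V - {y}) E'"
    and "card E' \<le> card E"
    and "card E \<le> card E' + 2 + 2 * card (E `` {x} \<inter> E `` {y})"
    and "\<And>k. has_clique_minor (V - {y}) E' k \<Longrightarrow> has_clique_minor V E k"
proof
  define f where "f v = (if v = y then x else v)" for v
  let ?E = "map_prod f f ` E - Id"
  let ?T = "E `` {x} \<inter> E `` {y}"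
  \<comment> \<open>\<open>?R\<close> holds one representative too many of every collapsing pair,
    and the arcs that become loops. Outside it the contraction is injective.\<close>
  let ?R = "{(x, y), (y, x)} \<union> ({y} \<times> ?T \<union> ?T \<times> {y})"
  have E: "finite V" "E \<subseteq> V \<times> V" "sym E" "irrefl E"
    using G by (auto simp: finite_simple_graph_def)
  have xV: "x \<in> V" "y \<in> V" "x \<noteq> y" "(y, x) \<in> E"
    using E xy by (auto simp: irrefl_def sym_def)
  have finE: "finite E"
    using E finite_subset by blast
  have nl: "(u, u) \<notin> E" for u
    using E(4) by (simp add: irrefl_def)
  have sE: "(u, w) \<in> E \<Longrightarrow> (w, u) \<in> E" for u w
    using E(3) by (auto dest: symD)
  show "finite_simple_graph (V - {y}) ?E"
    unfolding finite_simple_graph_def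
  proof (intro conjI)
    show "?E \<subseteq> (V - {y}) \<times> (V - {y})"
    proof
      fix p assume "p \<in> ?E"
      then obtain u w where p: "(u, w) \<in> E" "p = (f u, f w)"
        by auto
      have "u \<in> V" "w \<in> V"
        using E(2) p(1) by auto
      then show "p \<in> (V - {y}) \<times> (V - {y})"
        using xV p(2) by (simp add: f_def)
    qed
    show "sym ?E"
    proof (rule symI)
      fix a b assume "(a, b) \<in> ?E"
      then obtain u w where "(u, w) \<in> E" "a = f u" "b = f w" "a \<noteq> b"
        by auto
      then show "(b, a) \<in> ?E"
        using imageI[OF sE[of u w], of "map_prod f f"] by simp
    qed
    show "irrefl ?E"
      by (auto simp: irrefl_def)
  qed (use E in auto)
  show "card ?E \<le> card E"
    using finE by (meson Diff_subset card_image_le card_mono finite_imageI le_trans)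
  have finT: "finite ?T"
    using finE by (simp add: finite_Image)
  have "inj_on (map_prod f f) (E - ?R)"
  proof (rule inj_onI)
    fix p q assume p: "p \<in> E - ?R" and q: "q \<in> E - ?R" and eq: "map_prod f f p = map_prod f f q"
    obtain a b c d where pq: "p = (a, b)" "q = (c, d)"
      by (metis surj_pair)
    have in_E: "(a, b) \<in> E" "(c, d) \<in> E" "(b, a) \<in> E" "(d, c) \<in> E"
      using p q pq sE by auto
    have "f a = f c" "f b = f d"
      using eq pq by auto
    \<comment> \<open>Distinct arcs with equal images either join a common neighbour to both
      \<open>x\<close> and \<open>y\<close>, and one of them lies in \<open>?R\<close>, or have all
      ends in \<open>{x, y}\<close> and are loops or in \<open>?R\<close>.\<close>
    then consider "a = c" "b = d" | "a = c" "{b, d} = {x, y}" | "b = d" "{a, c} = {x, y}"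
      | "{a, c} = {x, y}" "{b, d} = {x, y}"
      unfolding f_def by (auto split: if_splits)
    then show "p = q"
    proof cases
      case 1
      then show ?thesis by (simp add: pq)
    next
      case 2
      then show ?thesis
        using in_E p q unfolding pq doubleton_eq_iff by auto
    next
      case 3
      then show ?thesis
        using in_E p q unfolding pq doubleton_eq_iff by auto
    next
      case 4
      then show ?thesis
        using in_E p q nl unfolding pq doubleton_eq_iff by auto
    qed
  qed
  moreover have "map_prod f f ` (E - ?R) \<subseteq> ?E"
  proof
    fix p assume "p \<in> map_prod f f ` (E - ?R)"
    then obtain u w where p: "(u, w) \<in> E" "(u, w) \<notin> ?R" "p = (f u, f w)"
      by auto
    then have "f u \<noteq> f w"
      using nl unfolding f_def by (auto split: if_splits)
    then show "p \<in> ?E"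
      using imageI[OF p(1), of "map_prod f f"] p(3) by simp
  qed
  ultimately have "card (E - ?R) \<le> card ?E"
    using finE by (intro card_inj_on_le[of "map_prod f f"]) auto
  moreover have "card E \<le> card (E - ?R) + card ?R"
    using diff_card_le_card_Diff[of ?R E] finT by simp
  moreover have "card ?R \<le> 2 + 2 * card ?T"
  proof -
    have "card ?R \<le> card {(x, y), (y, x)} + card ({y} \<times> ?T \<union> ?T \<times> {y})"
      by (rule card_Un_le)
    also have "\<dots> \<le> 2 + (card ({y} \<times> ?T) + card (?T \<times> {y}))"
      using xV(3) by (intro add_mono card_Un_le) auto
    finally show ?thesis
      by (simp add: card_cartesian_product)
  qed
  ultimately show "card E \<le> card ?E + 2 + 2 * card ?T"
    by linarith
  show "has_clique_minor V E k" if "has_clique_minor (V - {y}) ?E k" for k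
  proof (rule has_clique_minor_contract_fibres[OF _ E(2) _ that])
    show "f ` V = V - {y}"
      using xV by (auto simp: f_def image_iff)
    fix a assume a: "a \<in> V - {y}"
    show "connected_set E {v \<in> V. f v = a}"
    proof (cases "a = x")
      case True
      then have "{v \<in> V. f v = a} = {x, y}"
        using xV by (auto simp: f_def)
      then show ?thesis
        using xy xV(4) unfolding connected_set_def by (auto intro!: r_into_rtrancl)
    next
      case False
      then have "{v \<in> V. f v = a} = {a}"
        using a by (auto simp: f_def)
      then show ?thesis
        by (simp add: connected_set_singleton)
    qed
  qed
qed

subsection \<open>Edge density forces clique minors\<close>

lemma finite_simple_graph_delete_edge:
  assumes G: "finite_simple_graph V E" and xy: "(x, y) \<in> E"
  shows "finite_simple_graph V (E - {(x, y), (y, x)})"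
    and "card E = card (E - {(x, y), (y, x)}) + 2"
proof -
  have E: "finite V" "E \<subseteq> V \<times> V" "sym E" "irrefl E"
    using G by (auto simp: finite_simple_graph_def)
  show "finite_simple_graph V (E - {(x, y), (y, x)})"
    using E unfolding finite_simple_graph_def sym_def irrefl_def by blast
  have "finite E"
    using E finite_subset by blast
  moreover have R: "{(x, y), (y, x)} \<subseteq> E" "x \<noteq> y"
    using E xy by (auto simp: sym_def irrefl_def)
  moreover have "card {(x, y), (y, x)} = 2"
    using R by auto
  ultimately show "card E = card (E - {(x, y), (y, x)}) + 2"
    by (metis add.commute card_Diff_subset card_mono finite.emptyI finite.insertI
      le_add_diff_inverse)
qed

text \<open>Parity serves to round up an odd lower bound in \<open>clique_minor_5\<close>.\<close>

lemma even_card_arcs: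
  assumes "finite_simple_graph V E"
  shows "even (card E)"
  using assms
proof (induction "card E" arbitrary: E rule: less_induct)
  case less
  show ?case
  proof (cases "E = {}")
    case False
    then obtain x y where xy: "(x, y) \<in> E" by auto
    show ?thesis
      using less.hyps[OF _ finite_simple_graph_delete_edge(1)[OF less.prems xy]]
        finite_simple_graph_delete_edge(2)[OF less.prems xy] by simp
  qed simp
qed

lemma card_arcs_eq_sum_degrees:
  assumes "finite_simple_graph V E"
  shows "card E = (\<Sum>v\<in>V. card (E `` {v}))"
proof -
  have E: "finite V" "E \<subseteq> V \<times> V"
    using assms by (auto simp: finite_simple_graph_def)
  have "E = Sigma V (\<lambda>v. E `` {v})"
    using E by auto
  moreover have "finite (E `` {v})" for v
    using E by (meson finite_Image finite_SigmaI finite_subset)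
  ultimately show ?thesis
    using E(1) by (metis card_SigmaI)
qed

lemma card_arcs_le:
  assumes G: "finite_simple_graph V E"
  shows "card E \<le> card V * (card V - 1)"
proof -
  have E: "finite V" "E \<subseteq> V \<times> V" "irrefl E"
    using G by (auto simp: finite_simple_graph_def)
  have "card (E `` {v}) \<le> card V - 1" if "v \<in> V" for v
  proof -
    have "E `` {v} \<subseteq> V - {v}"
      using E by (auto simp: irrefl_def)
    then have "card (E `` {v}) \<le> card (V - {v})"
      using E(1) by (intro card_mono) auto
    then show ?thesis
      using that by simp
  qed
  then show ?thesis
    unfolding card_arcs_eq_sum_degrees[OF G]
    using sum_bounded_above[of V "\<lambda>v. card (E `` {v})" "card V - 1"] by simp
qed

text \<open>The bound is the number of arcs of the complete graph, so \<open>E\<close> is complete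
  and the singletons form the minor.\<close>

lemma complete_has_clique_minor:
  assumes G: "finite_simple_graph V E" and c: "card V * (card V - 1) \<le> card E"
  shows "has_clique_minor V E (card V)"
proof -
  have E: "finite V" "E \<subseteq> V \<times> V" "irrefl E"
    using G by (auto simp: finite_simple_graph_def)
  let ?K = "V \<times> V - Id_on V"
  have "card ?K = card V * (card V - 1)"
  proof -
    have "?K = Sigma V (\<lambda>v. V - {v})" by auto
    then show ?thesis
      using E(1) by (simp add: card_SigmaI)
  qed
  moreover have "E \<subseteq> ?K"
    using E by (auto simp: irrefl_def)
  ultimately have EK: "E = ?K"
    using c E(1) by (intro card_seteq) auto
  have "clique_minor V E ((\<lambda>v. {v}) ` V)"
    unfolding clique_minor_def EK
    by (auto simp: connected_set_singleton pairwise_def disjnt_def adjacent_sets_def)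
  then show ?thesis
    unfolding has_clique_minor_def using E(1)
    by (intro exI[of _ "(\<lambda>v. {v}) ` V"]) (auto simp: card_image)
qed

text \<open>Induction on vertices plus arcs replaces the choice of a minimal counterexample.
  \<open>base\<close> settles the smallest vertex count \<open>m\<close>, below which no reduction
  may go; \<open>link\<close> is to be applied to the neighbourhood of a vertex once no reduction is
  possible.\<close>

lemma clique_minor_if_dense:
  fixes a m k :: nat and b :: int
  assumes base: "\<And>(V :: 'a set) E. finite_simple_graph V E \<Longrightarrow> card V = m \<Longrightarrow>
      2 * (int a * int m - b) \<le> int (card E) \<Longrightarrow> has_clique_minor V E (Suc k)"
    and link: "\<And>(V :: 'a set) E. finite_simple_graph V E \<Longrightarrow> V \<noteq> {} \<Longrightarrow> a \<le> card V \<Longrightarrow>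
      a * card V \<le> card E \<Longrightarrow> (0 < b \<Longrightarrow> card V < 2 * a) \<Longrightarrow> has_clique_minor V E k"
  shows "finite_simple_graph (V :: 'a set) E \<Longrightarrow> m \<le> card V \<Longrightarrow>
      2 * (int a * int (card V) - b) \<le> int (card E) \<Longrightarrow> has_clique_minor V E (Suc k)"
proof (induction "card V + card E" arbitrary: V E rule: less_induct)
  case less
  note G = less.prems(1)
  have E: "finite V" "E \<subseteq> V \<times> V" "sym E" "irrefl E"
    using G by (auto simp: finite_simple_graph_def)
  have finE: "finite E"
    using E finite_subset by blast
  show ?case
  proof (cases "card V = m")
    case True
    then show ?thesis using base G less.prems(3) by simp
  next
    case False
    then have m: "m < card V" using less.prems(2) by simp
    then have ne: "V \<noteq> {}" by auto
    consider (isolated) v where "v \<in> V" "E `` {v} = {}"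
      | (contract) x y where "(x, y) \<in> E" "card (E `` {x} \<inter> E `` {y}) < a"
      | (surplus) x y where "(x, y) \<in> E" "2 * (int a * int (card V) - b) + 2 \<le> int (card E)"
      | (tight) "\<forall>v\<in>V. E `` {v} \<noteq> {}" "\<forall>(x, y)\<in>E. a \<le> card (E `` {x} \<inter> E `` {y})"
          "int (card E) < 2 * (int a * int (card V) - b) + 2"
    proof (cases "\<exists>v\<in>V. E `` {v} = {}")
      case True
      then show thesis using isolated by blast
    next
      case False
      then obtain x y where xy: "(x, y) \<in> E"
        using ne by blast
      show thesis
      proof (cases "\<exists>(x, y)\<in>E. card (E `` {x} \<inter> E `` {y}) < a")
        case True
        then show thesis using contract by blast
      next
        case no_contract: False
        then have "\<forall>(x, y)\<in>E. a \<le> card (E `` {x} \<inter> E `` {y})"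
          by (fastforce simp: not_less)
        then show thesis
          using False xy surplus tight
          by (cases "2 * (int a * int (card V) - b) + 2 \<le> int (card E)") (simp_all add: not_le)
      qed
    qed
    then show ?thesis
    proof cases
      case isolated
      have "E \<subseteq> (V - {v}) \<times> (V - {v})"
        using E isolated by (auto simp: sym_def)
      then have "finite_simple_graph (V - {v}) E"
        using E by (auto simp: finite_simple_graph_def)
      moreover have c: "card V = Suc (card (V - {v}))"
        using isolated E(1) by (metis card.remove)
      ultimately have "has_clique_minor (V - {v}) E (Suc k)"
        using less.prems(3) m by (intro less.hyps) (auto simp: algebra_simps)
      then show ?thesis
        by (rule has_clique_minor_mono) auto
    next
      case contract
      obtain E' where E': "finite_simple_graph (V - {y}) E'"
        "card E \<le> card E' + 2 + 2 * card (E `` {x} \<inter> E `` {y})"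
        "card E' \<le> card E"
        "\<And>k. has_clique_minor (V - {y}) E' k \<Longrightarrow> has_clique_minor V E k"
        using contract_edge[OF G contract(1)] by metis
      have c: "card V = Suc (card (V - {y}))"
        using contract(1) E by (metis SigmaD2 card.remove subsetD)
      \<comment> \<open>Fewer than \<open>a\<close> triangles contain the edge, so at most
        \<open>2 * a\<close> arcs are lost, which is what the bound drops by with one vertex
        less.\<close>
      have "has_clique_minor (V - {y}) E' (Suc k)"
        using E' c m contract(2) less.prems(3)
        by (intro less.hyps) (auto simp: algebra_simps)
      then show ?thesis
        by (rule E'(4))
    next
      case surplus
      note del = finite_simple_graph_delete_edge[OF G surplus(1)]
      have "has_clique_minor V (E - {(x, y), (y, x)}) (Suc k)"
        using del surplus(2) less.prems(2) by (intro less.hyps) auto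
      then show ?thesis
        by (rule has_clique_minor_mono) auto
    next
      case tight
      \<comment> \<open>If \<open>b > 0\<close>, tightness puts the average degree below
        \<open>2 * a\<close>; if not, any vertex will do.\<close>
      have "\<exists>v\<in>V. 0 < b \<longrightarrow> card (E `` {v}) < 2 * a"
      proof (rule ccontr)
        assume "\<not> ?thesis"
        then have all: "\<forall>v\<in>V. 2 * a \<le> card (E `` {v})" "0 < b"
          using ne by (auto simp: not_less)
        then have "card V * (2 * a) \<le> card E"
          unfolding card_arcs_eq_sum_degrees[OF G] by (metis of_nat_id sum_bounded_below)
        then have "2 * (int a * int (card V)) \<le> int (card E)"
          by (metis (no_types, opaque_lifting) mult.assoc mult.commute of_nat_le_iff of_nat_mult of_nat_numeral)
        then show False
          using tight(3) all(2) by (simp add: right_diff_distrib)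
      qed
      then obtain v where v: "v \<in> V" "0 < b \<longrightarrow> card (E `` {v}) < 2 * a"
        by blast
      let ?W = "E `` {v}" and ?F = "E \<inter> E `` {v} \<times> E `` {v}"
      have FW: "finite_simple_graph ?W ?F"
        using E finE unfolding finite_simple_graph_def sym_def irrefl_def
        by (auto intro: finite_Image)
      \<comment> \<open>The degree of \<open>w\<close> in the link of \<open>v\<close> counts the
        triangles through the edge \<open>vw\<close>.\<close>
      have deg: "a \<le> card (?F `` {w})" if "w \<in> ?W" for w
      proof -
        have "?F `` {w} = E `` {v} \<inter> E `` {w}"
          using that by auto
        then show ?thesis
          using tight(2) that by fastforce
      qed
      have W: "?W \<noteq> {}" "finite ?W"
        using tight(1) v(1) finE by (auto intro: finite_Image)
      then obtain w where w: "w \<in> ?W" by blast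
      have "card (?F `` {w}) \<le> card ?W"
        using W(2) by (intro card_mono) auto
      then have "a \<le> card ?W"
        using deg[OF w] by simp
      moreover have "a * card ?W \<le> card ?F"
        unfolding card_arcs_eq_sum_degrees[OF FW]
        using sum_bounded_below[of ?W a "\<lambda>w. card (?F `` {w})"] deg by (simp add: mult.commute)
      ultimately have "has_clique_minor ?W ?F k"
        using link[OF FW W(1)] v(2) by blast
      then show ?thesis
        by (rule has_clique_minor_cone[OF G v(1)])
    qed
  qed
qed

section \<open>Edge thresholds for clique minors of sizes 1 to 6\<close>

lemma clique_minor_1:
  assumes "v \<in> V"
  shows "has_clique_minor V E 1"
  unfolding has_clique_minor_def
  using assms by (intro exI[of _ "{{v}}"]) (auto simp: clique_minor_def connected_set_singleton)

lemma clique_minor_2: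
  assumes G: "finite_simple_graph V E" and "E \<noteq> {}"
  shows "has_clique_minor V E 2"
proof -
  obtain x y where xy: "(x, y) \<in> E"
    using assms(2) by auto
  then have "x \<in> V"
    using G by (auto simp: finite_simple_graph_def)
  moreover have "has_clique_minor (E `` {x}) (E \<inter> (E `` {x}) \<times> (E `` {x})) 1"
    using xy by (intro clique_minor_1[of y]) auto
  ultimately show ?thesis
    using has_clique_minor_cone[OF G] by (metis Suc_1)
qed

text \<open>A single vertex has no arcs, so the base case cannot occur. In the link one edge
  suffices.\<close>

lemma clique_minor_3:
  assumes "finite_simple_graph V E" "1 \<le> card V" "2 * int (card V) \<le> int (card E)"
  shows "has_clique_minor V E 3"
proof -
  have "has_clique_minor V E (Suc 2)"
  proof (rule clique_minor_if_dense[where a = 1 and m = 1 and b = 0])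
    fix V :: "'a set" and E
    assume "finite_simple_graph V E" "card V = 1" "2 * (int 1 * int 1 - 0) \<le> int (card E)"
    then show "has_clique_minor V E (Suc 2)"
      using card_arcs_le[of V E] by simp
  next
    fix V :: "'a set" and E
    assume "finite_simple_graph V E" "1 \<le> card V" "1 * card V \<le> card E"
    then show "has_clique_minor V E 2"
      by (intro clique_minor_2) auto
  qed (use assms in auto)
  then show ?thesis by simp
qed

text \<open>Two vertices carry at most 2 of the 4 arcs demanded in the base case. The link meets the
  bound of \<open>clique_minor_3\<close> exactly.\<close>

lemma clique_minor_4:
  assumes "finite_simple_graph V E" "2 \<le> card V" "2 * (2 * int (card V) - 2) \<le> int (card E)"
  shows "has_clique_minor V E 4"
proof -
  have "has_clique_minor V E (Suc 3)"
  proof (rule clique_minor_if_dense[where a = 2 and m = 2 and b = 2])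
    fix V :: "'a set" and E
    assume "finite_simple_graph V E" "card V = 2" "2 * (int 2 * int 2 - 2) \<le> int (card E)"
    then show "has_clique_minor V E (Suc 3)"
      using card_arcs_le[of V E] by simp
  next
    fix V :: "'a set" and E
    assume "finite_simple_graph V E" "2 \<le> card V" "2 * card V \<le> card E"
    then show "has_clique_minor V E 3"
      by (intro clique_minor_3) auto
  qed (use assms in auto)
  then show ?thesis by simp
qed

text \<open>Three vertices carry at most 6 of the 8 arcs demanded in the base case.\<close>

lemma clique_minor_5:
  assumes "finite_simple_graph V E" "3 \<le> card V" "2 * (3 * int (card V) - 5) \<le> int (card E)"
  shows "has_clique_minor V E 5"
proof -
  have "has_clique_minor V E (Suc 4)"
  proof (rule clique_minor_if_dense[where a = 3 and m = 3 and b = 5])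
    fix V :: "'a set" and E
    assume "finite_simple_graph V E" "card V = 3" "2 * (int 3 * int 3 - 5) \<le> int (card E)"
    then show "has_clique_minor V E (Suc 4)"
      using card_arcs_le[of V E] by simp
  next
    fix V :: "'a set" and E
    assume G: "finite_simple_graph V E" and d: "3 \<le> card V" "3 * card V \<le> card E"
      "0 < (5 :: int) \<Longrightarrow> card V < 2 * 3"
    \<comment> \<open>On at most 5 vertices, \<open>3 * n\<close> arcs fall short of the required
      \<open>4 * n - 4\<close> only for \<open>n = 5\<close>, with 15 against 16. Parity closes this
      gap.\<close>
    obtain j where "card E = 2 * j"
      using even_card_arcs[OF G] by auto
    then have "2 * (2 * card V - 2) \<le> card E"
      using d by presburger
    then have "2 * (2 * int (card V) - 2) \<le> int (card E)"
      using d(1) by simp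
    then show "has_clique_minor V E 4"
      using G d(1) by (intro clique_minor_4) auto
  qed (use assms in auto)
  then show ?thesis by simp
qed

text \<open>
  The argument does not give Mader's optimal bound \<open>4 n - 9\<close>: there the neighbourhood could be an
  octahedron, which has no clique minor of size 5.
\<close>

lemma clique_minor_6:
  assumes "finite_simple_graph V E" "6 \<le> card V" "2 * (5 * int (card V) - 15) \<le> int (card E)"
  shows "has_clique_minor V E 6"
proof -
  have "has_clique_minor V E (Suc 5)"
  proof (rule clique_minor_if_dense[where a = 5 and m = 6 and b = 15])
    fix V :: "'a set" and E
    assume "finite_simple_graph V E" "card V = 6" "2 * (int 5 * int 6 - 15) \<le> int (card E)"
    \<comment> \<open>Here the bound is 30 = 6 * 5 arcs, so the graph is complete.\<close>
    then show "has_clique_minor V E (Suc 5)"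
      using complete_has_clique_minor[of V E] by simp
  next
    fix V :: "'a set" and E
    assume "finite_simple_graph V E" "5 \<le> card V" "5 * card V \<le> card E"
      "0 < (15 :: int) \<Longrightarrow> card V < 2 * 5"
    \<comment> \<open>\<open>5 * n\<close> arcs reach the bound \<open>6 * n - 10\<close> of
      \<open>clique_minor_5\<close> as long as \<open>n \<le> 10\<close>.\<close>
    then show "has_clique_minor V E 5"
      by (intro clique_minor_5) auto
  qed (use assms in auto)
  then show ?thesis by simp
qed

subsection \<open>Kempe chains in uniquely colorable graphs\<close>

text \<open>A path inside \<open>S\<close> from \<open>T\<close> to its complement must leave
  \<open>T\<close> at some step.\<close>

lemma connected_set_crossing:
  assumes conn: "connected_set E S" and T: "T \<subseteq> S" "T \<noteq> {}" "T \<noteq> S"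
  obtains u w where "u \<in> T" "w \<in> S - T" "(u, w) \<in> E"
proof -
  obtain t s where ts: "t \<in> T" "s \<in> S - T"
    using T by blast
  then have "(t, s) \<in> (E \<inter> S \<times> S)\<^sup>*"
    using conn T by (auto simp: connected_set_def)
  then have "\<exists>u w. u \<in> T \<and> w \<in> S - T \<and> (u, w) \<in> E"
    using ts(2)
  proof (induction rule: rtrancl_induct)
    case (step y z)
    then show ?case by (cases "y \<in> T") auto
  qed (use ts(1) in auto)
  then show thesis
    using that by blast
qed

text \<open>A spanning tree is grown vertex by vertex, each crossing edge contributing two
  arcs.\<close>

lemma connected_set_card_arcs:
  assumes S: "finite S" and conn: "connected_set E S" and "sym E"
  shows "2 * (card S - 1) \<le> card (E \<inter> S \<times> S)"
proof -
  have "\<exists>T\<subseteq>S. card T = Suc n \<and> 2 * n \<le> card (E \<inter> T \<times> T)" if "n < card S" for n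
    using that
  proof (induction n)
    case 0
    then obtain s where "s \<in> S" by fastforce
    then show ?case by (intro exI[of _ "{s}"]) auto
  next
    case (Suc n)
    then obtain T where T: "T \<subseteq> S" "card T = Suc n" "2 * n \<le> card (E \<inter> T \<times> T)"
      by auto
    then obtain u w where uw: "u \<in> T" "w \<in> S - T" "(u, w) \<in> E"
      using Suc.prems by (metis card.empty connected_set_crossing[OF conn] less_irrefl nat.distinct(1))
    have fin: "finite T"
      using S T finite_subset by blast
    have "{(u, w), (w, u)} \<union> E \<inter> T \<times> T \<subseteq> E \<inter> insert w T \<times> insert w T"
      using uw \<open>sym E\<close> by (auto dest: symD)
    then have "card ({(u, w), (w, u)} \<union> E \<inter> T \<times> T) \<le> card (E \<inter> insert w T \<times> insert w T)"
      using fin by (intro card_mono) auto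
    moreover have "card ({(u, w), (w, u)} \<union> E \<inter> T \<times> T) = 2 + card (E \<inter> T \<times> T)"
    proof -
      have "card {(u, w), (w, u)} = 2"
        using uw by (subst card_2_iff) auto
      then show ?thesis
        using fin uw by (subst card_Un_disjoint) auto
    qed
    ultimately show ?case
      using T uw fin by (intro exI[of _ "insert w T"]) auto
  qed
  then show ?thesis
  proof (cases "card S")
    case (Suc n)
    then obtain T where T: "T \<subseteq> S" "card T = Suc n" "2 * n \<le> card (E \<inter> T \<times> T)"
      using \<open>\<And>n. n < card S \<Longrightarrow> _\<close>[of n] by auto
    then have "T = S"
      using S Suc by (metis card_subset_eq)
    then show ?thesis
      using T Suc by simp
  qed simp
qed

section \<open>Color exchange between two classes\<close>

lemma partition_on_replace_two:
  assumes P: "partition_on V C" and AB: "A \<in> C" "B \<in> C"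
    and A'B': "A' \<union> B' = A \<union> B" "A' \<inter> B' = {}"
  shows "partition_on V ((C - {A, B}) \<union> ({A', B'} - {{}}))"
proof (rule partition_onI)
  have un: "\<Union> C = V" and dj: "disjoint C" and ne: "{} \<notin> C"
    using P by (auto simp: partition_on_def)
  show "\<Union> ((C - {A, B}) \<union> ({A', B'} - {{}})) = V"
  proof -
    have "\<Union> ((C - {A, B}) \<union> ({A', B'} - {{}})) = \<Union> (C - {A, B}) \<union> (A \<union> B)"
      using A'B'(1) by auto
    also have "\<dots> = V"
      using un AB by auto
    finally show ?thesis .
  qed
  have out: "disjnt D A' \<and> disjnt D B'" if "D \<in> C - {A, B}" for D
  proof -
    have "D \<inter> A = {}" "D \<inter> B = {}"
      using dj that AB by (auto simp: disjoint_def)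
    then show ?thesis
      using A'B'(1) unfolding disjnt_def by blast
  qed
  fix p q assume "p \<in> (C - {A, B}) \<union> ({A', B'} - {{}})" "q \<in> (C - {A, B}) \<union> ({A', B'} - {{}})" "p \<noteq> q"
  then consider "p \<in> C" "q \<in> C" | "p \<in> C - {A, B}" "q \<in> {A', B'}" | "p \<in> {A', B'}" "q \<in> C - {A, B}"
    | "p \<in> {A', B'}" "q \<in> {A', B'}" by blast
  then show "disjnt p q"
  proof cases
    case 1
    then show ?thesis using dj \<open>p \<noteq> q\<close> by (auto simp: pairwise_def)
  next
    case 2
    then show ?thesis using out by blast
  next
    case 3
    then show ?thesis using out disjnt_sym by blast
  next
    case 4
    then show ?thesis using A'B'(2) \<open>p \<noteq> q\<close> by (auto simp: disjnt_def)
  qed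
qed (use P in \<open>auto simp: partition_on_def\<close>)

lemma unique_coloring_union_connected:
  assumes G: "finite_simple_graph V E"
    and C: "coloring V E C" "card C = chromatic_number V E"
    and unique: "\<And>D. coloring V E D \<Longrightarrow> card D = chromatic_number V E \<Longrightarrow> D = C"
    and AB: "A \<in> C" "B \<in> C" "A \<noteq> B"
  shows "connected_set E (A \<union> B)"
proof (rule ccontr)
  assume "\<not> connected_set E (A \<union> B)"
  then obtain u w where uw: "u \<in> A \<union> B" "w \<in> A \<union> B"
    "(u, w) \<notin> (E \<inter> (A \<union> B) \<times> (A \<union> B))\<^sup>*"
    unfolding connected_set_def by blast
  \<comment> \<open>\<open>K\<close> is the Kempe component of \<open>u\<close>, and
    \<open>A'\<close>, \<open>B'\<close> arise by exchanging the two colors on it. One of them might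
    be empty, hence the removal of \<open>{}\<close> in \<open>D\<close>.\<close>
  define K where "K = {z. (u, z) \<in> (E \<inter> (A \<union> B) \<times> (A \<union> B))\<^sup>*}"
  define A' where "A' = (A - K) \<union> (B \<inter> K)"
  define B' where "B' = (B - K) \<union> (A \<inter> K)"
  define D where "D = (C - {A, B}) \<union> ({A', B'} - {{}})"
  have E: "finite V" "sym E"
    using G by (auto simp: finite_simple_graph_def)
  have part: "partition_on V C" and anti: "\<And>X. X \<in> C \<Longrightarrow> anticlique E X"
    using C by (auto simp: coloring_def)
  have dj: "A \<inter> B = {}"
    using part AB by (auto simp: partition_on_def disjoint_def)
  have closed: "z \<in> K" if "y \<in> K" "(y, z) \<in> E" "y \<in> A \<union> B" "z \<in> A \<union> B" for y z
    using that unfolding K_def by (auto intro: rtrancl_into_rtrancl)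
  have closed': "z \<in> K" if "y \<in> K" "(z, y) \<in> E" "y \<in> A \<union> B" "z \<in> A \<union> B" for y z
    using closed that E(2) by (meson symD)
  have "anticlique E A'" "anticlique E B'"
    using anti[OF AB(1)] anti[OF AB(2)] closed closed'
    unfolding anticlique_def A'_def B'_def by blast+
  moreover have "partition_on V D"
    unfolding D_def using dj by (intro partition_on_replace_two[OF part AB(1,2)])
      (auto simp: A'_def B'_def)
  ultimately have D: "coloring V E D"
    using anti by (auto simp: coloring_def D_def)
  have finC: "finite C"
    using part E(1) by (meson finite_elements)
  have le: "chromatic_number V E \<le> card D"
    unfolding chromatic_number_def using D by (intro Least_le) blast
  have "card D \<le> card (C - {A, B}) + card ({A', B'} - {{}})"
    unfolding D_def by (rule card_Un_le)
  moreover have "card (C - {A, B}) + 2 = card C"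
    using AB finC by (metis card_Diff_subset card_2_iff card_mono empty_subsetI finite.emptyI
      finite.insertI insert_subset le_add_diff_inverse2)
  moreover have "card ({A', B'} - {{}}) \<le> card {A', B'}" "card {A', B'} \<le> 2"
    by (simp add: card_mono, simp add: card_insert_if)
  \<comment> \<open>Minimality forbids losing a class, so \<open>A'\<close> and \<open>B'\<close>
    are distinct and nonempty, and uniqueness applies to \<open>D\<close>.\<close>
  ultimately have "card D = chromatic_number V E" and two: "card ({A', B'} - {{}}) = 2"
    using le C(2) by linarith+
  have "A' \<noteq> {}"
  proof
    assume "A' = {}"
    then have "{A', B'} - {{}} \<subseteq> {B'}" by auto
    then show False
      using two card_mono[of "{B'}" "{A', B'} - {{}}"] by simp
  qed
  moreover have "D = C"
    by (rule unique) fact+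
  ultimately have "A' \<in> C"
    by (auto simp: D_def)
  have "A' = A \<or> A' = B"
  proof (rule ccontr)
    assume "\<not> (A' = A \<or> A' = B)"
    then have "A' \<inter> A = {}" "A' \<inter> B = {}"
      using part AB \<open>A' \<in> C\<close> by (auto simp: partition_on_def disjoint_def)
    then show False
      using \<open>A' \<noteq> {}\<close> by (auto simp: A'_def)
  qed
  \<comment> \<open>\<open>A' = A\<close> would make \<open>K\<close> miss
    \<open>A \<union> B\<close>, although \<open>u\<close> lies in both; \<open>A' = B\<close> would
    put all of \<open>A \<union> B\<close>, including \<open>w\<close>, into
    \<open>K\<close>.\<close>
  then show False
    using uw dj unfolding A'_def K_def by blast
qed

text \<open>Connectedness gives at least \<open>card A + card B - 1\<close> edges between two
  classes. Over the ordered pairs of distinct classes, with \<open>k = card C\<close>, each vertex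
  is counted \<open>2 * (k - 1)\<close> times and 1 is subtracted \<open>k * (k - 1)\<close>
  times.\<close>

lemma unique_coloring_card_arcs:
  assumes G: "finite_simple_graph V E"
    and C: "coloring V E C" "card C = chromatic_number V E"
    and unique: "\<And>D. coloring V E D \<Longrightarrow> card D = chromatic_number V E \<Longrightarrow> D = C"
  shows "2 * (int (card C) - 1) * int (card V) - int (card C) * (int (card C) - 1) \<le> int (card E)"
proof -
  have E: "finite V" "E \<subseteq> V \<times> V" "sym E"
    using G by (auto simp: finite_simple_graph_def)
  have part: "partition_on V C" and anti: "\<And>X. X \<in> C \<Longrightarrow> anticlique E X"
    using C by (auto simp: coloring_def)
  have finC: "finite C"
    using part E(1) by (meson finite_elements)
  have un: "\<Union> C = V" and dj: "\<And>A B. A \<in> C \<Longrightarrow> B \<in> C \<Longrightarrow> A \<noteq> B \<Longrightarrow> A \<inter> B = {}"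
    using part by (auto simp: partition_on_def disjoint_def)
  have fin: "finite A" if "A \<in> C" for A
    using that un E(1) by (metis Union_upper finite_subset)
  let ?N = "\<lambda>A B. int (card (E \<inter> A \<times> B))"
  let ?c = "\<lambda>A. int (card A)"
  have nV: "?c V = (\<Sum>A\<in>C. ?c A)"
    using card_Union_disjoint[of C] part fin un by (auto simp: partition_on_def)
  have pair: "?c A + ?c B - 1 \<le> ?N A B" if AB: "A \<in> C" "B \<in> C" "A \<noteq> B" for A B
  proof -
    have ne: "A \<noteq> {}"
      using part AB by (auto simp: partition_on_def)
    have "connected_set E (A \<union> B)"
      using G C unique AB by (rule unique_coloring_union_connected)
    then have "2 * (card (A \<union> B) - 1) \<le> card (E \<inter> (A \<union> B) \<times> (A \<union> B))"
      using fin AB E(3) by (intro connected_set_card_arcs) auto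
    moreover have "card (A \<union> B) = card A + card B"
      using fin AB dj by (intro card_Un_disjoint) auto
    ultimately have "2 * (card A + card B - 1) \<le> card (E \<inter> (A \<union> B) \<times> (A \<union> B))"
      by metis
    also have "E \<inter> (A \<union> B) \<times> (A \<union> B) = E \<inter> A \<times> B \<union> E \<inter> B \<times> A"
      using anti[OF AB(1)] anti[OF AB(2)] unfolding anticlique_def by blast
    also have "card \<dots> \<le> card (E \<inter> A \<times> B) + card (E \<inter> B \<times> A)"
      by (rule card_Un_le)
    also have "E \<inter> B \<times> A = prod.swap ` (E \<inter> A \<times> B)"
      using E(3) by (force simp: sym_def)
    also have "card \<dots> = card (E \<inter> A \<times> B)"
      by (intro card_image) (auto simp: inj_on_def)
    finally have "card A + card B - 1 \<le> card (E \<inter> A \<times> B)"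
      by simp
    \<comment> \<open>Since \<open>A\<close> is nonempty, the truncated subtraction agrees with the
      integer one.\<close>
    then show ?thesis
      using ne fin[OF AB(1)] by (simp add: card_gt_0_iff)
  qed
  have "E = (\<Union>p\<in>C \<times> C. E \<inter> fst p \<times> snd p)"
  proof -
    have "\<exists>A\<in>C. a \<in> A" "\<exists>B\<in>C. b \<in> B" if "(a, b) \<in> E" for a b
      using that E(2) un by blast+
    then show ?thesis by fastforce
  qed
  moreover have "card (\<Union>p\<in>C \<times> C. E \<inter> fst p \<times> snd p) = (\<Sum>p\<in>C \<times> C. card (E \<inter> fst p \<times> snd p))"
  proof (intro card_UN_disjoint ballI impI)
    fix p q assume pq: "p \<in> C \<times> C" "q \<in> C \<times> C" "p \<noteq> q"
    then have "fst p \<inter> fst q = {} \<or> snd p \<inter> snd q = {}"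
      using dj by (metis mem_Times_iff prod_eqI)
    then show "(E \<inter> fst p \<times> snd p) \<inter> (E \<inter> fst q \<times> snd q) = {}"
      by auto
  qed (use finC fin in auto)
  ultimately have "int (card E) = (\<Sum>(A, B)\<in>C \<times> C. ?N A B)"
    by (simp add: case_prod_beta)
  also have "\<dots> = (\<Sum>A\<in>C. \<Sum>B\<in>C. ?N A B)"
    by (simp add: sum.cartesian_product)
  finally have cE: "int (card E) = (\<Sum>A\<in>C. \<Sum>B\<in>C. ?N A B)" .
  \<comment> \<open>The full double sum is easy to evaluate; the subtracted sum is its diagonal
    \<open>B = A\<close>.\<close>
  have "(\<Sum>A\<in>C. \<Sum>B\<in>C. ?c A + ?c B - 1) - (\<Sum>A\<in>C. 2 * ?c A - 1)
      = (\<Sum>A\<in>C. \<Sum>B\<in>C - {A}. ?c A + ?c B - 1)"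
    unfolding sum_subtractf[symmetric] using finC by (intro sum.cong) (auto simp: sum_diff1)
  also have "\<dots> \<le> (\<Sum>A\<in>C. \<Sum>B\<in>C - {A}. ?N A B)"
    by (intro sum_mono pair) auto
  also have "\<dots> \<le> (\<Sum>A\<in>C. \<Sum>B\<in>C. ?N A B)"
    using finC by (intro sum_mono sum_mono2) auto
  finally have "(\<Sum>A\<in>C. \<Sum>B\<in>C. ?c A + ?c B - 1) - (\<Sum>A\<in>C. 2 * ?c A - 1) \<le> int (card E)"
    unfolding cE .
  then show ?thesis
    by (simp add: sum.distrib sum_subtractf sum_distrib_left[symmetric] sum_distrib_right[symmetric]
        nV left_diff_distrib right_diff_distrib)
qed

theorem theorem1:
  fixes V :: "'a set" and E :: "'a rel"
  assumes "finite_simple_graph V E"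
    and "chromatic_number V E \<le> 6"
    and "\<exists>!C. coloring V E C \<and> card C = chromatic_number V E"
  shows "hadwiger_number V E \<ge> chromatic_number V E"
proof -
  obtain C where C: "coloring V E C" "card C = chromatic_number V E"
    and unique: "\<And>D. coloring V E D \<Longrightarrow> card D = chromatic_number V E \<Longrightarrow> D = C"
    using assms(3) by blast
  have finV: "finite V" and part: "partition_on V C"
    using assms(1) C(1) by (auto simp: finite_simple_graph_def coloring_def)
  define k where "k = card C"
  have arcs: "2 * (int k - 1) * int (card V) - int k * (int k - 1) \<le> int (card E)"
    unfolding k_def by (rule unique_coloring_card_arcs[OF assms(1) C unique])
  have kV: "k \<le> card V"
  proof -
    have fin: "finite A" "A \<noteq> {}" if "A \<in> C" for A
      using that part finV by (auto simp: partition_on_def intro: finite_subset)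
    have "card V = sum card C"
      using card_Union_disjoint[of C] part fin by (auto simp: partition_on_def)
    moreover have "(\<Sum>A\<in>C. 1) \<le> sum card C"
      using fin by (intro sum_mono) (simp add: Suc_le_eq card_gt_0_iff)
    ultimately show ?thesis
      by (simp add: k_def)
  qed
  have "k \<le> 6"
    using assms(2) C(2) by (simp add: k_def)
  then consider "k = 0" | "k = 1" | "k = 2" | "k = 3" | "k = 4" | "k = 5" | "k = 6"
    by linarith
  \<comment> \<open>With \<open>n = card V\<close>, the guaranteed number of edges exceeds the
    threshold by \<open>n - k\<close> for \<open>k = 3, 4, 5\<close> and equals it for
    \<open>k = 6\<close>. So \<open>kV\<close> closes these cases and also supplies the least vertex
    counts.\<close>
  then have "has_clique_minor V E k"
  proof cases
    case 1
    then show ?thesis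
      unfolding has_clique_minor_def by (intro exI[of _ "{}"]) (auto simp: clique_minor_def)
  next
    case 2
    then obtain v where "v \<in> V"
      using kV by fastforce
    then show ?thesis
      using 2 clique_minor_1 by simp
  next
    case 3
    then have "E \<noteq> {}"
      using arcs kV by auto
    then show ?thesis
      using 3 clique_minor_2[OF assms(1)] by simp
  next
    case 4
    then show ?thesis
      using arcs kV clique_minor_3[OF assms(1)] by simp
  next
    case 5
    then show ?thesis
      using arcs kV clique_minor_4[OF assms(1)] by simp
  next
    case 6
    then show ?thesis
      using arcs kV clique_minor_5[OF assms(1)] by simp
  next
    case 7
    then show ?thesis
      using arcs kV clique_minor_6[OF assms(1)] by simp
  qed
  then show ?thesis
    using hadwiger_number_ge[OF finV] C(2) by (simp add: k_def)
qed

end
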